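(* Let $A$ be a $\phi$-module with three trilinear maps $\{\,,\,,\,\}_i:A\times A\times A\to A$, $i\in\{1,2,3\}$. Then $(A,\{\,,\,,\,\}_i)$ is an associative triple trisystem of the first kind if and only if $(\mathrm{U}(A),\dashv,\vdash)$ is an associative dialgebra. Moreover, $\{x,y,z\}_1=x\dashv(y\dashv z)$, $\{x,y,z\}_2=x\vdash(y\dashv z)$ and $\{x,y,z\}_3=x\vdash(y\vdash z)$ in $\mathrm{U}(A)$, for all $x,y,z\in A$.
   Context: $\phi$ is a scalar ring (commutative, unital) with $\frac12\in\phi$. An associative dialgebra is a $\phi$-module $D$ with two bilinear products $\dashv,\vdash:D\times D\to D$ satisfying, for all $a,b,c\in D$: $(a\dashv b)\dashv c=a\dashv(b\dashv c)$; $(a\vdash b)\dashv c=a\vdash(b\dashv c)$; $(a\vdash b)\vdash c=a\vdash(b\vdash c)$; $a\dashv(b\dashv c)=a\dashv(b\vdash c)$; $(a\dashv b)\vdash c=(a\vdash b)\vdash c$. An associative triple trisystem of the first kind is a $\phi$-module $A$ with three trilinear maps $\{\,,\,,\,\}_i:A\times A\times A\to A$, $i\in\{1,2,3\}$, satisfying for all $a,b,c,d,e\in A$: (1) $\{\{a,b,c\}_1,d,e\}_1=\{a,\{b,c,d\}_1,e\}_1=\{a,b,\{c,d,e\}_1\}_1$; (2) $\{\{a,b,c\}_2,d,e\}_1=\{a,\{b,c,d\}_1,e\}_2=\{a,b,\{c,d,e\}_1\}_2$; (3) $\{\{a,b,c\}_3,d,e\}_1=\{a,\{b,c,d\}_2,e\}_2=\{a,b,\{c,d,e\}_1\}_3$;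 (4) $\{\{a,b,c\}_3,d,e\}_2=\{a,\{b,c,d\}_3,e\}_2=\{a,b,\{c,d,e\}_2\}_3$; (5) $\{\{a,b,c\}_3,d,e\}_3=\{a,\{b,c,d\}_3,e\}_3=\{a,b,\{c,d,e\}_3\}_3$; (6) $\{\{a,b,c\}_1,d,e\}_2=\{\{a,b,c\}_2,d,e\}_2=\{\{a,b,c\}_3,d,e\}_2$; (7) $\{\{a,b,c\}_1,d,e\}_3=\{\{a,b,c\}_2,d,e\}_3=\{\{a,b,c\}_3,d,e\}_3$; (8) $\{a,\{b,c,d\}_1,e\}_1=\{a,\{b,c,d\}_2,e\}_1=\{a,\{b,c,d\}_3,e\}_1$; (9) $\{a,\{b,c,d\}_1,e\}_3=\{a,\{b,c,d\}_2,e\}_3=\{a,\{b,c,d\}_3,e\}_3$; (10) $\{a,b,\{c,d,e\}_1\}_1=\{a,b,\{c,d,e\}_2\}_1=\{a,b,\{c,d,e\}_3\}_1$; (11) $\{a,b,\{c,d,e\}_1\}_2=\{a,b,\{c,d,e\}_2\}_2=\{a,b,\{c,d,e\}_3\}_2$. Di-endomorphisms. For a $\phi$-module $A$, $\mathrm{DiEnd}(A)$ is the module $\mathrm{End}(A)\oplus\mathrm{End}(A)$ with actions $f\prec x:=f_1(x)$, $f\succ x:=f_2(x)$ for $f=(f_1,f_2)$, $x\in A$, and products $f\dashv g:=(f_1\circ g_2,f_2\circ g_2)$, $f\vdash g:=(f_2\circ g_1,f_2\circ g_2)$. $\mathrm{DiEnd}(A)^{\mathrm{op}}$ is the same module, whose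 elements are written $\bar f$ ($f\in\mathrm{DiEnd}(A)$), with right actions $x\prec\bar f:=f_2(x)$, $x\succ\bar f:=f_1(x)$ and products $\bar f\dashv\bar g:=\overline{g\vdash f}$, $\bar f\vdash\bar g:=\overline{g\dashv f}$. Given three trilinear maps $\{\,,\,,\,\}_i$ on $A$, put $L_i(x,y)(z):=\{x,y,z\}_i$ and $R_i(x,y)(z):=\{z,x,y\}_i$, and define $L^\triangleleft(x,y)=(L_1(x,y),L_3(x,y))$, $L^\triangleright(x,y)=(L_2(x,y),L_3(x,y))$, $R^\triangleleft(x,y)=(R_2(x,y),R_1(x,y))$, $R^\triangleright(x,y)=(R_3(x,y),R_1(x,y))$ in $\mathrm{DiEnd}(A)$. Let $\mathfrak M(A,A)$ be the $\phi$-submodule of $\mathrm{DiEnd}(A)\oplus\mathrm{DiEnd}(A)^{\mathrm{op}}$ generated by all $x\triangleleft y:=L^\triangleleft(x,y)\oplus\overline{R^\triangleleft(x,y)}$ and $x\triangleright y:=L^\triangleright(x,y)\oplus\overline{R^\triangleright(x,y)}$, $x,y\in A$. The products $\dashv,\vdash$ of elements of $\mathfrak M(A,A)$ are computed componentwise in $\mathrm{DiEnd}(A)\oplus\mathrm{DiEnd}(A)^{\mathrm{op}}$. For $m=f\oplus\bar g\in\mathfrak M(A,A)$ and $z\in A$, put $m\prec z:=f\prec z$, $m\succ z:=f\succ z$, $z\prec m:=z\prec\bar g$, $z\succ m:=z\succ\bar g$. The standard embedding is $\mathrm U(A):=\mathfrak M(A,A)\oplus A$ with bilinear products $\dashv,\vdash$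 given by: $x\dashv y:=x\triangleleft y$, $x\vdash y:=x\triangleright y$ for $x,y\in A$; $m\dashv z:=m\prec z$, $m\vdash z:=m\succ z$, $z\dashv m:=z\prec m$, $z\vdash m:=z\succ m$ for $m\in\mathfrak M(A,A)$, $z\in A$; and on $\mathfrak M(A,A)$ the componentwise products above. Explicitly, $(x\triangleleft y)\dashv z=\{x,y,z\}_1$, $(x\triangleleft y)\vdash z=\{x,y,z\}_3$, $z\dashv(x\triangleleft y)=\{z,x,y\}_1$, $z\vdash(x\triangleleft y)=\{z,x,y\}_2$, $(x\triangleright y)\dashv z=\{x,y,z\}_2$, $(x\triangleright y)\vdash z=\{x,y,z\}_3$, $z\dashv(x\triangleright y)=\{z,x,y\}_1$, $z\vdash(x\triangleright y)=\{z,x,y\}_3$. The assertion that $(\mathrm U(A),\dashv,\vdash)$ is an associative dialgebra includes that $\mathfrak M(A,A)$ is closed under its two componentwise products. *)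

theory Defs
  imports HOL.Modules "HOL-Library.Function_Algebras" "HOL-Library.Product_Plus"
begin

section \<open>Associative dialgebras\<close>

text \<open>
  The underlying module of a dialgebra is a submodule \<open>D\<close> of an ambient module given by a type and
  a scalar multiplication; the products only matter on \<open>D\<close>. Closure of \<open>D\<close> under both products
  is part of the definition.
\<close>

locale assoc_dialgebra = module scale
  for scale :: "'r::comm_ring_1 \<Rightarrow> 'a::ab_group_add \<Rightarrow> 'a" +
  fixes D :: "'a set"
    and left :: "'a \<Rightarrow> 'a \<Rightarrow> 'a"  (infixl "\<stileturn>" 70)
    and right :: "'a \<Rightarrow> 'a \<Rightarrow> 'a"  (infixl "\<turnstile>" 70)
  assumes submodule: "subspace D"
    and left_closed: "\<lbrakk>a \<in> D; b \<in> D\<rbrakk> \<Longrightarrow> a \<stileturn> b \<in> D"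
    and right_closed: "\<lbrakk>a \<in> D; b \<in> D\<rbrakk> \<Longrightarrow> a \<turnstile> b \<in> D"
    and left_add1: "\<lbrakk>a \<in> D; a' \<in> D; b \<in> D\<rbrakk> \<Longrightarrow> (a + a') \<stileturn> b = a \<stileturn> b + a' \<stileturn> b"
    and left_add2: "\<lbrakk>a \<in> D; b \<in> D; b' \<in> D\<rbrakk> \<Longrightarrow> a \<stileturn> (b + b') = a \<stileturn> b + a \<stileturn> b'"
    and left_scale1: "\<lbrakk>a \<in> D; b \<in> D\<rbrakk> \<Longrightarrow> scale r a \<stileturn> b = scale r (a \<stileturn> b)"
    and left_scale2: "\<lbrakk>a \<in> D; b \<in> D\<rbrakk> \<Longrightarrow> a \<stileturn> scale r b = scale r (a \<stileturn> b)"
    and right_add1: "\<lbrakk>a \<in> D; a' \<in> D; b \<in> D\<rbrakk> \<Longrightarrow> (a + a') \<turnstile> b = a \<turnstile> b + a' \<turnstile> b"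
    and right_add2: "\<lbrakk>a \<in> D; b \<in> D; b' \<in> D\<rbrakk> \<Longrightarrow> a \<turnstile> (b + b') = a \<turnstile> b + a \<turnstile> b'"
    and right_scale1: "\<lbrakk>a \<in> D; b \<in> D\<rbrakk> \<Longrightarrow> scale r a \<turnstile> b = scale r (a \<turnstile> b)"
    and right_scale2: "\<lbrakk>a \<in> D; b \<in> D\<rbrakk> \<Longrightarrow> a \<turnstile> scale r b = scale r (a \<turnstile> b)"
    and left_left: "\<lbrakk>a \<in> D; b \<in> D; c \<in> D\<rbrakk> \<Longrightarrow> (a \<stileturn> b) \<stileturn> c = a \<stileturn> (b \<stileturn> c)"
    and right_left: "\<lbrakk>a \<in> D; b \<in> D; c \<in> D\<rbrakk> \<Longrightarrow> (a \<turnstile> b) \<stileturn> c = a \<turnstile> (b \<stileturn> c)"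
    and right_right: "\<lbrakk>a \<in> D; b \<in> D; c \<in> D\<rbrakk> \<Longrightarrow> (a \<turnstile> b) \<turnstile> c = a \<turnstile> (b \<turnstile> c)"
    and left_bar: "\<lbrakk>a \<in> D; b \<in> D; c \<in> D\<rbrakk> \<Longrightarrow> a \<stileturn> (b \<stileturn> c) = a \<stileturn> (b \<turnstile> c)"
    and right_bar: "\<lbrakk>a \<in> D; b \<in> D; c \<in> D\<rbrakk> \<Longrightarrow> (a \<stileturn> b) \<turnstile> c = (a \<turnstile> b) \<turnstile> c"


section \<open>Associative triple trisystems of the first kind\<close>

locale trilinear = module scale
  for scale :: "'r::comm_ring_1 \<Rightarrow> 'a::ab_group_add \<Rightarrow> 'a" +
  fixes t :: "'a \<Rightarrow> 'a \<Rightarrow> 'a \<Rightarrow> 'a"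
  assumes linear1: "module_hom scale scale (\<lambda>x. t x y z)"
    and linear2: "module_hom scale scale (\<lambda>y. t x y z)"
    and linear3: "module_hom scale scale (\<lambda>z. t x y z)"

locale assoc_triple_trisystem1 =
  T1: trilinear scale t1 + T2: trilinear scale t2 + T3: trilinear scale t3
  for scale :: "'r::comm_ring_1 \<Rightarrow> 'a::ab_group_add \<Rightarrow> 'a"
    and t1 t2 t3 :: "'a \<Rightarrow> 'a \<Rightarrow> 'a \<Rightarrow> 'a" +
  assumes ax1: "t1 (t1 a b c) d e = t1 a (t1 b c d) e"  "t1 a (t1 b c d) e = t1 a b (t1 c d e)"
    and ax2: "t1 (t2 a b c) d e = t2 a (t1 b c d) e"  "t2 a (t1 b c d) e = t2 a b (t1 c d e)"
    and ax3: "t1 (t3 a b c) d e = t2 a (t2 b c d) e"  "t2 a (t2 b c d) e = t3 a b (t1 c d e)"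
    and ax4: "t2 (t3 a b c) d e = t2 a (t3 b c d) e"  "t2 a (t3 b c d) e = t3 a b (t2 c d e)"
    and ax5: "t3 (t3 a b c) d e = t3 a (t3 b c d) e"  "t3 a (t3 b c d) e = t3 a b (t3 c d e)"
    and ax6: "t2 (t1 a b c) d e = t2 (t2 a b c) d e"  "t2 (t2 a b c) d e = t2 (t3 a b c) d e"
    and ax7: "t3 (t1 a b c) d e = t3 (t2 a b c) d e"  "t3 (t2 a b c) d e = t3 (t3 a b c) d e"
    and ax8: "t1 a (t1 b c d) e = t1 a (t2 b c d) e"  "t1 a (t2 b c d) e = t1 a (t3 b c d) e"
    and ax9: "t3 a (t1 b c d) e = t3 a (t2 b c d) e"  "t3 a (t2 b c d) e = t3 a (t3 b c d) e"
    and ax10: "t1 a b (t1 c d e) = t1 a b (t2 c d e)"  "t1 a b (t2 c d e) = t1 a b (t3 c d e)"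
    and ax11: "t2 a b (t1 c d e) = t2 a b (t2 c d e)"  "t2 a b (t2 c d e) = t2 a b (t3 c d e)"


section \<open>Module structures on functions and pairs\<close>

definition scale_fun :: "('r \<Rightarrow> 'b \<Rightarrow> 'b) \<Rightarrow> 'r \<Rightarrow> ('a \<Rightarrow> 'b) \<Rightarrow> 'a \<Rightarrow> 'b" where
  "scale_fun s r f = (\<lambda>x. s r (f x))"

definition scale_prod ::
    "('r \<Rightarrow> 'a \<Rightarrow> 'a) \<Rightarrow> ('r \<Rightarrow> 'b \<Rightarrow> 'b) \<Rightarrow> 'r \<Rightarrow> 'a \<times> 'b \<Rightarrow> 'a \<times> 'b" where
  "scale_prod s1 s2 r p = (s1 r (fst p), s2 r (snd p))"

lemma module_scale_fun: "module s \<Longrightarrow> module (scale_fun s)"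
  by (auto simp: module_def scale_fun_def fun_eq_iff)

lemma module_scale_prod: "module s1 \<Longrightarrow> module s2 \<Longrightarrow> module (scale_prod s1 s2)"
  by (auto simp: module_def scale_prod_def prod_eq_iff)


section \<open>Di-endomorphisms\<close>

type_synonym 'a diend = "('a \<Rightarrow> 'a) \<times> ('a \<Rightarrow> 'a)"

definition DiEnd :: "('r::comm_ring_1 \<Rightarrow> 'a::ab_group_add \<Rightarrow> 'a) \<Rightarrow> 'a diend set" where
  "DiEnd scale = {f. module_hom scale scale f} \<times> {f. module_hom scale scale f}"

abbreviation scale_diend :: "('r \<Rightarrow> 'a \<Rightarrow> 'a) \<Rightarrow> 'r \<Rightarrow> 'a diend \<Rightarrow> 'a diend" where
  "scale_diend s \<equiv> scale_prod (scale_fun s) (scale_fun s)"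

definition diend_prec :: "'a diend \<Rightarrow> 'a \<Rightarrow> 'a" where
  "diend_prec f x = fst f x"

definition diend_succ :: "'a diend \<Rightarrow> 'a \<Rightarrow> 'a" where
  "diend_succ f x = snd f x"

definition diend_left :: "'a diend \<Rightarrow> 'a diend \<Rightarrow> 'a diend" where
  "diend_left f g = (fst f \<circ> snd g, snd f \<circ> snd g)"

definition diend_right :: "'a diend \<Rightarrow> 'a diend \<Rightarrow> 'a diend" where
  "diend_right f g = (snd f \<circ> fst g, snd f \<circ> snd g)"

text \<open>
  The opposite \<open>DiEnd(A)\<^sup>o\<^sup>p\<close> has the same underlying module, so a barred element is represented by
  the element itself; only the operations (prefix \<open>op_\<close>) differ. The right actions take
  the element of \<open>A\<close> first.
\<close>

definition op_prec :: "'a \<Rightarrow> 'a diend \<Rightarrow> 'a" where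
  "op_prec x f = snd f x"

definition op_succ :: "'a \<Rightarrow> 'a diend \<Rightarrow> 'a" where
  "op_succ x f = fst f x"

definition op_left :: "'a diend \<Rightarrow> 'a diend \<Rightarrow> 'a diend" where
  "op_left f g = diend_right g f"

definition op_right :: "'a diend \<Rightarrow> 'a diend \<Rightarrow> 'a diend" where
  "op_right f g = diend_left g f"


section \<open>The module \<open>\<MM>(A,A)\<close>\<close>

definition Lop :: "('a \<Rightarrow> 'a \<Rightarrow> 'a \<Rightarrow> 'a) \<Rightarrow> 'a \<Rightarrow> 'a \<Rightarrow> 'a \<Rightarrow> 'a" where
  "Lop t x y = (\<lambda>z. t x y z)"

definition Rop :: "('a \<Rightarrow> 'a \<Rightarrow> 'a \<Rightarrow> 'a) \<Rightarrow> 'a \<Rightarrow> 'a \<Rightarrow> 'a \<Rightarrow> 'a" where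
  "Rop t x y = (\<lambda>z. t z x y)"

text \<open>Elements of \<open>DiEnd(A) \<oplus> DiEnd(A)\<^sup>o\<^sup>p\<close>; the second component is understood as barred.\<close>

type_synonym 'a dipair = "'a diend \<times> 'a diend"

abbreviation scale_dipair :: "('r \<Rightarrow> 'a \<Rightarrow> 'a) \<Rightarrow> 'r \<Rightarrow> 'a dipair \<Rightarrow> 'a dipair" where
  "scale_dipair s \<equiv> scale_prod (scale_diend s) (scale_diend s)"

context
  fixes t1 t2 t3 :: "'a \<Rightarrow> 'a \<Rightarrow> 'a \<Rightarrow> 'a"
begin

definition tri_left :: "'a \<Rightarrow> 'a \<Rightarrow> 'a dipair" where
  "tri_left x y = ((Lop t1 x y, Lop t3 x y), (Rop t2 x y, Rop t1 x y))"

definition tri_right :: "'a \<Rightarrow> 'a \<Rightarrow> 'a dipair" where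
  "tri_right x y = ((Lop t2 x y, Lop t3 x y), (Rop t3 x y, Rop t1 x y))"

end

definition MM :: "('r::comm_ring_1 \<Rightarrow> 'a::ab_group_add \<Rightarrow> 'a) \<Rightarrow> ('a \<Rightarrow> 'a \<Rightarrow> 'a \<Rightarrow> 'a) \<Rightarrow>
    ('a \<Rightarrow> 'a \<Rightarrow> 'a \<Rightarrow> 'a) \<Rightarrow> ('a \<Rightarrow> 'a \<Rightarrow> 'a \<Rightarrow> 'a) \<Rightarrow> 'a dipair set" where
  "MM scale t1 t2 t3 = module.span (scale_dipair scale)
     ({tri_left t1 t2 t3 x y | x y. True} \<union> {tri_right t1 t2 t3 x y | x y. True})"

definition MM_left :: "'a dipair \<Rightarrow> 'a dipair \<Rightarrow> 'a dipair" where
  "MM_left m n = (diend_left (fst m) (fst n), op_left (snd m) (snd n))"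

definition MM_right :: "'a dipair \<Rightarrow> 'a dipair \<Rightarrow> 'a dipair" where
  "MM_right m n = (diend_right (fst m) (fst n), op_right (snd m) (snd n))"


section \<open>The standard embedding \<open>U(A) = \<MM>(A,A) \<oplus> A\<close>\<close>

type_synonym 'a emb = "'a dipair \<times> 'a"

abbreviation scale_U :: "('r \<Rightarrow> 'a \<Rightarrow> 'a) \<Rightarrow> 'r \<Rightarrow> 'a emb \<Rightarrow> 'a emb" where
  "scale_U s \<equiv> scale_prod (scale_dipair s) s"

definition U_carrier :: "('r::comm_ring_1 \<Rightarrow> 'a::ab_group_add \<Rightarrow> 'a) \<Rightarrow> ('a \<Rightarrow> 'a \<Rightarrow> 'a \<Rightarrow> 'a) \<Rightarrow>
    ('a \<Rightarrow> 'a \<Rightarrow> 'a \<Rightarrow> 'a) \<Rightarrow> ('a \<Rightarrow> 'a \<Rightarrow> 'a \<Rightarrow> 'a) \<Rightarrow> 'a emb set" where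
  "U_carrier scale t1 t2 t3 = MM scale t1 t2 t3 \<times> UNIV"

text \<open>The inclusion of \<open>A\<close> as the second direct summand.\<close>

definition U_incl :: "'a::ab_group_add \<Rightarrow> 'a emb" where
  "U_incl x = (0, x)"

text \<open>
  The products are the biadditive extensions of the prescribed products on the four combinations
  of summands: the \<open>\<MM>\<close>-component collects the products of two elements of \<open>\<MM>(A,A)\<close> and of
  two elements of \<open>A\<close>, the \<open>A\<close>-component collects the mixed ones.
\<close>

definition U_left :: "('a::ab_group_add \<Rightarrow> 'a \<Rightarrow> 'a \<Rightarrow> 'a) \<Rightarrow> ('a \<Rightarrow> 'a \<Rightarrow> 'a \<Rightarrow> 'a) \<Rightarrow>
    ('a \<Rightarrow> 'a \<Rightarrow> 'a \<Rightarrow> 'a) \<Rightarrow> 'a emb \<Rightarrow> 'a emb \<Rightarrow> 'a emb" where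
  "U_left t1 t2 t3 = (\<lambda>(m, x) (n, y).
     (MM_left m n + tri_left t1 t2 t3 x y, diend_prec (fst m) y + op_prec x (snd n)))"

definition U_right :: "('a::ab_group_add \<Rightarrow> 'a \<Rightarrow> 'a \<Rightarrow> 'a) \<Rightarrow> ('a \<Rightarrow> 'a \<Rightarrow> 'a \<Rightarrow> 'a) \<Rightarrow>
    ('a \<Rightarrow> 'a \<Rightarrow> 'a \<Rightarrow> 'a) \<Rightarrow> 'a emb \<Rightarrow> 'a emb \<Rightarrow> 'a emb" where
  "U_right t1 t2 t3 = (\<lambda>(m, x) (n, y).
     (MM_right m n + tri_right t1 t2 t3 x y, diend_succ (fst m) y + op_succ x (snd n)))"


section \<open>Consistency checks\<close>

lemma module_scale_dipair: "module s \<Longrightarrow> module (scale_dipair s)"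
  by (intro module_scale_prod module_scale_fun)

lemma module_scale_U: "module s \<Longrightarrow> module (scale_U s)"
  by (intro module_scale_prod module_scale_fun)

lemma subspace_prod:
  assumes "module s1" "module s2" "module.subspace s1 S" "module.subspace s2 T"
  shows "module.subspace (scale_prod s1 s2) (S \<times> T)"
  using assms module_scale_prod[OF assms(1,2)]
  by (auto simp: module.subspace_def scale_prod_def zero_prod_def)

lemma subspace_module_hom:
  assumes "module s"
  shows "module.subspace (scale_fun s) {f. module_hom s s f}"
proof -
  interpret module s by fact
  interpret module_pair s s ..
  interpret F: module "scale_fun s" by (rule module_scale_fun) fact
  have "module_hom s s 0"
    using module_hom_zero by (simp add: zero_fun_def)
  moreover have "module_hom s s (f + g)" if "module_hom s s f" "module_hom s s g" for f g
    using module_hom_add[OF that] by (simp add: plus_fun_def)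
  moreover have "module_hom s s (scale_fun s c f)" if "module_hom s s f" for c f
    using module_hom_scale[OF that] by (simp add: scale_fun_def)
  ultimately show ?thesis by (auto simp: F.subspace_def)
qed

lemma MM_subset_DiEnd:
  assumes "trilinear scale t1" "trilinear scale t2" "trilinear scale t3"
  shows "MM scale t1 t2 t3 \<subseteq> DiEnd scale \<times> DiEnd scale"
proof -
  have m: "module scale" using assms(1) by (simp add: trilinear_def)
  interpret P: module "scale_dipair scale" by (rule module_scale_dipair[OF m])
  have sub: "P.subspace (DiEnd scale \<times> DiEnd scale)"
    unfolding DiEnd_def
    by (intro subspace_prod subspace_module_hom module_scale_prod module_scale_fun m)
  show ?thesis
    unfolding MM_def
    by (rule P.span_minimal[OF _ sub])
      (use assms in \<open>auto simp: DiEnd_def tri_left_def tri_right_def Lop_def Rop_def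
         intro: trilinear.linear1 trilinear.linear3\<close>)
qed

lemma U_mixed_products:
  assumes "trilinear scale t1" "trilinear scale t2" "trilinear scale t3"
  defines "L \<equiv> U_left t1 t2 t3" and "R \<equiv> U_right t1 t2 t3"
  shows "L (U_incl x) (U_incl y) = (tri_left t1 t2 t3 x y, 0)"
    and "R (U_incl x) (U_incl y) = (tri_right t1 t2 t3 x y, 0)"
    and "L (tri_left t1 t2 t3 x y, 0) (U_incl z) = U_incl (t1 x y z)"
    and "R (tri_left t1 t2 t3 x y, 0) (U_incl z) = U_incl (t3 x y z)"
    and "L (U_incl z) (tri_left t1 t2 t3 x y, 0) = U_incl (t1 z x y)"
    and "R (U_incl z) (tri_left t1 t2 t3 x y, 0) = U_incl (t2 z x y)"
    and "L (tri_right t1 t2 t3 x y, 0) (U_incl z) = U_incl (t2 x y z)"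
    and "R (tri_right t1 t2 t3 x y, 0) (U_incl z) = U_incl (t3 x y z)"
    and "L (U_incl z) (tri_right t1 t2 t3 x y, 0) = U_incl (t1 z x y)"
    and "R (U_incl z) (tri_right t1 t2 t3 x y, 0) = U_incl (t3 z x y)"
proof -
  have z: "t x y 0 = 0 \<and> t x 0 y = 0 \<and> t 0 x y = 0" if "trilinear scale t" for t x y
    using module_hom.zero[OF trilinear.linear1[OF that]]
      module_hom.zero[OF trilinear.linear2[OF that]]
      module_hom.zero[OF trilinear.linear3[OF that]]
    by blast
  note d = L_def R_def U_left_def U_right_def U_incl_def MM_left_def MM_right_def tri_left_def
    tri_right_def diend_left_def diend_right_def op_left_def op_right_def diend_prec_def
    diend_succ_def op_prec_def op_succ_def Lop_def Rop_def zero_prod_def fun_eq_iff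
    z[OF assms(1)] z[OF assms(2)] z[OF assms(3)]
  show "L (U_incl x) (U_incl y) = (tri_left t1 t2 t3 x y, 0)"
    and "R (U_incl x) (U_incl y) = (tri_right t1 t2 t3 x y, 0)"
    and "L (tri_left t1 t2 t3 x y, 0) (U_incl z) = U_incl (t1 x y z)"
    and "R (tri_left t1 t2 t3 x y, 0) (U_incl z) = U_incl (t3 x y z)"
    and "L (U_incl z) (tri_left t1 t2 t3 x y, 0) = U_incl (t1 z x y)"
    and "R (U_incl z) (tri_left t1 t2 t3 x y, 0) = U_incl (t2 z x y)"
    and "L (tri_right t1 t2 t3 x y, 0) (U_incl z) = U_incl (t2 x y z)"
    and "R (tri_right t1 t2 t3 x y, 0) (U_incl z) = U_incl (t3 x y z)"
    and "L (U_incl z) (tri_right t1 t2 t3 x y, 0) = U_incl (t1 z x y)"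
    and "R (U_incl z) (tri_right t1 t2 t3 x y, 0) = U_incl (t3 z x y)"
    by (simp_all add: d)
qed

end

theory Submission
  imports Defs
begin

text \<open>
  Both directions rest on the fact that a dialgebra monomial depends only on the order of its
  factors and on its centre. Of the 27 composites \<open>t\<^sub>i \<circ> t\<^sub>j\<close> of five
  factors, the axioms of a trisystem identify exactly those with the same centre, which leaves the
  five normal forms \<open>t1 a b (t1 c d e)\<close>, \<open>t2 a b (t1 c d e)\<close>,
  \<open>t3 a b (t1 c d e)\<close>, \<open>t3 a b (t2 c d e)\<close>, \<open>t3 a b (t3 c d e)\<close>.
  Since the dialgebra laws are trilinear, it suffices to check them on the generators of
  \<open>U(A)\<close>.
\<close>

section \<open>Dialgebras given by generators\<close>

context module
begin

definition linear_on :: "'b set \<Rightarrow> ('b \<Rightarrow> 'b) \<Rightarrow> bool" where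
  "linear_on W f \<longleftrightarrow>
     (\<forall>a\<in>W. \<forall>b\<in>W. f (a + b) = f a + f b) \<and> (\<forall>a\<in>W. \<forall>r. f (r *s a) = r *s f a)"

definition bilinear_on :: "'b set \<Rightarrow> ('b \<Rightarrow> 'b \<Rightarrow> 'b) \<Rightarrow> bool" where
  "bilinear_on W p \<longleftrightarrow> (\<forall>a\<in>W. \<forall>b\<in>W. p a b \<in> W) \<and>
     (\<forall>a\<in>W. linear_on W (p a)) \<and> (\<forall>b\<in>W. linear_on W (\<lambda>a. p a b))"

definition trilinear_on :: "'b set \<Rightarrow> ('b \<Rightarrow> 'b \<Rightarrow> 'b \<Rightarrow> 'b) \<Rightarrow> bool" where
  "trilinear_on W F \<longleftrightarrow> (\<forall>b\<in>W. \<forall>c\<in>W. linear_on W (\<lambda>a. F a b c)) \<and>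
     (\<forall>a\<in>W. \<forall>c\<in>W. linear_on W (\<lambda>b. F a b c)) \<and> (\<forall>a\<in>W. \<forall>b\<in>W. linear_on W (F a b))"

lemma linear_on_zero: "subspace W \<Longrightarrow> linear_on W f \<Longrightarrow> f 0 = 0"
  unfolding linear_on_def by (metis scale_zero_left subspace_0)

lemma linear_on_mem_span:
  assumes "subspace W" "subspace V" "G \<subseteq> W" "linear_on W f"
    and "\<And>g. g \<in> G \<Longrightarrow> f g \<in> V" and "a \<in> span G"
  shows "f a \<in> V"
proof -
  have "subspace {a \<in> W. f a \<in> V}"
    using assms(1,2,4) linear_on_zero[OF assms(1,4)]
    by (auto simp: subspace_def linear_on_def)
  with assms(3,5) have "span G \<subseteq> {a \<in> W. f a \<in> V}"
    by (intro span_minimal) auto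
  with assms(6) show ?thesis by auto
qed

lemma linear_on_eq_span:
  assumes "subspace W" "G \<subseteq> W" "linear_on W f" "linear_on W g"
    and "\<And>a. a \<in> G \<Longrightarrow> f a = g a" and "a \<in> span G"
  shows "f a = g a"
proof -
  have "linear_on W (\<lambda>a. f a - g a)"
    using assms(3,4) by (auto simp: linear_on_def scale_right_diff_distrib)
  from linear_on_mem_span[OF assms(1) _ assms(2) this, of "{0}"] assms(5,6)
  show ?thesis by simp
qed

lemma bilinear_on_mem_span:
  assumes W: "subspace W" "G \<subseteq> W" and p: "bilinear_on W p"
    and "\<And>a b. a \<in> G \<Longrightarrow> b \<in> G \<Longrightarrow> p a b \<in> span G"
    and "a \<in> span G" "b \<in> span G"
  shows "p a b \<in> span G"
proof -
  have sW: "span G \<subseteq> W" using W by (simp add: span_minimal)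
  have "p g b \<in> span G" if "g \<in> G" for g
    using linear_on_mem_span[OF W(1) subspace_span W(2)] p W(2) that assms(4,6)
    unfolding bilinear_on_def by blast
  moreover have "linear_on W (\<lambda>a. p a b)"
    using p sW assms(6) by (auto simp: bilinear_on_def)
  ultimately show ?thesis
    using linear_on_mem_span[OF W(1) subspace_span W(2), of "\<lambda>a. p a b"] assms(5) by blast
qed

lemma trilinear_on_eq_span:
  assumes W: "subspace W" "G \<subseteq> W" and FH: "trilinear_on W F" "trilinear_on W H"
    and eq: "\<And>a b c. a \<in> G \<Longrightarrow> b \<in> G \<Longrightarrow> c \<in> G \<Longrightarrow> F a b c = H a b c"
    and abc: "a \<in> span G" "b \<in> span G" "c \<in> span G"
  shows "F a b c = H a b c"
proof -
  have sW: "span G \<subseteq> W" using W by (simp add: span_minimal)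
  have 1: "F a b c = H a b c" if "a \<in> G" "b \<in> G" for a b
    using linear_on_eq_span[OF W, of "F a b" "H a b"] FH W(2) that eq abc(3)
    unfolding trilinear_on_def by blast
  have 2: "F a b c = H a b c" if "a \<in> G" for a
    using linear_on_eq_span[OF W, of "\<lambda>b. F a b c" "\<lambda>b. H a b c"] FH W(2) sW that 1 abc
    unfolding trilinear_on_def by blast
  show ?thesis
    using linear_on_eq_span[OF W, of "\<lambda>a. F a b c" "\<lambda>a. H a b c"] FH sW 2 abc
    unfolding trilinear_on_def by blast
qed

lemma trilinear_on_compose:
  assumes "bilinear_on W p" "bilinear_on W q"
  shows "trilinear_on W (\<lambda>a b c. p (q a b) c)" "trilinear_on W (\<lambda>a b c. p a (q b c))"
  using assms by (auto simp: trilinear_on_def bilinear_on_def linear_on_def)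

lemma assoc_dialgebra_spanI:
  assumes W: "subspace W" "G \<subseteq> W" and l: "bilinear_on W l" and r: "bilinear_on W r"
    and lG: "\<And>a b. a \<in> G \<Longrightarrow> b \<in> G \<Longrightarrow> l a b \<in> span G"
    and rG: "\<And>a b. a \<in> G \<Longrightarrow> b \<in> G \<Longrightarrow> r a b \<in> span G"
    and laws: "\<And>a b c. a \<in> G \<Longrightarrow> b \<in> G \<Longrightarrow> c \<in> G \<Longrightarrow> l (l a b) c = l a (l b c)"
      "\<And>a b c. a \<in> G \<Longrightarrow> b \<in> G \<Longrightarrow> c \<in> G \<Longrightarrow> l (r a b) c = r a (l b c)"
      "\<And>a b c. a \<in> G \<Longrightarrow> b \<in> G \<Longrightarrow> c \<in> G \<Longrightarrow> r (r a b) c = r a (r b c)"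
      "\<And>a b c. a \<in> G \<Longrightarrow> b \<in> G \<Longrightarrow> c \<in> G \<Longrightarrow> l a (l b c) = l a (r b c)"
      "\<And>a b c. a \<in> G \<Longrightarrow> b \<in> G \<Longrightarrow> c \<in> G \<Longrightarrow> r (l a b) c = r (r a b) c"
  shows "assoc_dialgebra scale (span G) l r"
proof
  have sW: "span G \<subseteq> W" using W by (simp add: span_minimal)
  note mem = bilinear_on_mem_span[OF W] and eq = trilinear_on_eq_span[OF W]
    and tri = trilinear_on_compose
  show "subspace (span G)" by simp
  fix a b c assume abc: "a \<in> span G" "b \<in> span G" "c \<in> span G"
  show "l (l a b) c = l a (l b c)" using eq[OF tri(1)[OF l l] tri(2)[OF l l] laws(1) abc] .
  show "l (r a b) c = r a (l b c)" using eq[OF tri(1)[OF l r] tri(2)[OF r l] laws(2) abc] .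
  show "r (r a b) c = r a (r b c)" using eq[OF tri(1)[OF r r] tri(2)[OF r r] laws(3) abc] .
  show "l a (l b c) = l a (r b c)" using eq[OF tri(2)[OF l l] tri(2)[OF l r] laws(4) abc] .
  show "r (l a b) c = r (r a b) c" using eq[OF tri(1)[OF r l] tri(1)[OF r r] laws(5) abc] .
qed (use bilinear_on_mem_span[OF W l lG] bilinear_on_mem_span[OF W r rG] l r
    span_minimal[OF W(2,1)] in \<open>auto simp: bilinear_on_def linear_on_def subset_iff\<close>)

end


section \<open>The standard embedding\<close>

lemmas U_defs = U_left_def U_right_def U_incl_def MM_left_def MM_right_def tri_left_def
  tri_right_def diend_left_def diend_right_def op_left_def op_right_def diend_prec_def
  diend_succ_def op_prec_def op_succ_def Lop_def Rop_def

lemma trilinear_add: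
  assumes "trilinear s t"
  shows "t (x + x') y z = t x y z + t x' y z" "t x (y + y') z = t x y z + t x y' z"
    "t x y (z + z') = t x y z + t x y z'"
  using assms by (simp_all add: trilinear.linear1[THEN module_hom.add]
      trilinear.linear2[THEN module_hom.add] trilinear.linear3[THEN module_hom.add])

lemma trilinear_scale:
  assumes "trilinear s t"
  shows "t (s r x) y z = s r (t x y z)" "t x (s r y) z = s r (t x y z)"
    "t x y (s r z) = s r (t x y z)"
  using assms by (simp_all add: trilinear.linear1[THEN module_hom.scale]
      trilinear.linear2[THEN module_hom.scale] trilinear.linear3[THEN module_hom.scale])

lemma trilinear_zero:
  assumes "trilinear s t"
  shows "t 0 y z = 0" "t x 0 z = 0" "t x y 0 = 0"
  using trilinear.linear1[OF assms, THEN module_hom.zero]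
    trilinear.linear2[OF assms, THEN module_hom.zero]
    trilinear.linear3[OF assms, THEN module_hom.zero] by auto

context
  fixes scale :: "'r::comm_ring_1 \<Rightarrow> 'a::ab_group_add \<Rightarrow> 'a"
    and t1 t2 t3 :: "'a \<Rightarrow> 'a \<Rightarrow> 'a \<Rightarrow> 'a"
  assumes tri: "trilinear scale t1" "trilinear scale t2" "trilinear scale t3"
begin

interpretation A: module scale using tri(1) by (simp add: trilinear_def)
interpretation P: module "scale_dipair scale"
  by (rule module_scale_dipair) (rule A.module_axioms)
interpretation U: module "scale_U scale"
  by (rule module_scale_U) (rule A.module_axioms)

definition U_gens :: "'a emb set" where
  "U_gens = range U_incl \<union> {(tri_left t1 t2 t3 x y, 0) | x y. True} \<union>
     {(tri_right t1 t2 t3 x y, 0) | x y. True}"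

lemma U_gens_cases:
  assumes "g \<in> U_gens"
  obtains x where "g = U_incl x" | x y where "g = (tri_left t1 t2 t3 x y, 0)"
    | x y where "g = (tri_right t1 t2 t3 x y, 0)"
  using assms by (auto simp: U_gens_def)

lemma U_incl_carrier: "U_incl x \<in> U_carrier scale t1 t2 t3"
  by (simp add: U_incl_def U_carrier_def MM_def P.span_zero)

lemma U_incl_eq_iff: "U_incl x = U_incl y \<longleftrightarrow> x = y"
  by (simp add: U_incl_def)

lemma U_carrier_eq_span: "U_carrier scale t1 t2 t3 = U.span U_gens"
proof
  let ?S = "{tri_left t1 t2 t3 x y | x y. True} \<union> {tri_right t1 t2 t3 x y | x y. True}"
  have sub: "U.subspace (U_carrier scale t1 t2 t3)"
    unfolding U_carrier_def MM_def
    by (intro subspace_prod P.module_axioms A.module_axioms P.subspace_span A.subspace_UNIV)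
  have "U_gens \<subseteq> U_carrier scale t1 t2 t3"
    by (auto simp: U_gens_def U_incl_carrier) (auto simp: U_carrier_def MM_def intro!: P.span_base)
  then show "U.span U_gens \<subseteq> U_carrier scale t1 t2 t3"
    using sub by (rule U.span_minimal)
  have "P.subspace {m. (m, 0) \<in> U.span U_gens}"
  proof (rule P.subspaceI)
    show "0 \<in> {m. (m, 0) \<in> U.span U_gens}"
      using U.span_zero[of U_gens] by (simp add: zero_prod_def)
    show "m + n \<in> {m. (m, 0) \<in> U.span U_gens}"
      if "m \<in> {m. (m, 0) \<in> U.span U_gens}" "n \<in> {m. (m, 0) \<in> U.span U_gens}" for m n
      using U.span_add[of "(m, 0)" U_gens "(n, 0)"] that by simp
    show "scale_dipair scale r m \<in> {m. (m, 0) \<in> U.span U_gens}"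
      if "m \<in> {m. (m, 0) \<in> U.span U_gens}" for r m
      using U.span_scale[of "(m, 0)" U_gens r] that
      by (simp add: scale_prod_def[of "scale_dipair scale" scale])
  qed
  then have MM: "MM scale t1 t2 t3 \<subseteq> {m. (m, 0) \<in> U.span U_gens}"
    unfolding MM_def by (intro P.span_minimal) (auto simp: U_gens_def intro!: U.span_base)
  show "U_carrier scale t1 t2 t3 \<subseteq> U.span U_gens"
  proof
    fix u assume u: "u \<in> U_carrier scale t1 t2 t3"
    obtain m x where [simp]: "u = (m, x)" by (cases u)
    have "(m, 0) \<in> U.span U_gens" using u MM by (auto simp: U_carrier_def)
    moreover have "U_incl x \<in> U.span U_gens" by (rule U.span_base) (simp add: U_gens_def)
    ultimately have "(m, 0) + U_incl x \<in> U.span U_gens" by (rule U.span_add)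
    then show "u \<in> U.span U_gens" by (simp add: U_incl_def)
  qed
qed

text \<open>The products are bilinear only where the first four components are linear maps.\<close>

definition U_ambient :: "'a emb set" where
  "U_ambient = (DiEnd scale \<times> DiEnd scale) \<times> UNIV"

lemma U_ambient_subspace: "U.subspace U_ambient"
  unfolding U_ambient_def DiEnd_def
  by (intro subspace_prod subspace_module_hom module_scale_prod module_scale_fun
      A.module_axioms A.subspace_UNIV)

lemma U_gens_ambient: "U_gens \<subseteq> U_ambient"
  using tri by (auto simp: U_gens_def U_ambient_def DiEnd_def U_defs zero_fun_def zero_prod_def
      module_hom_iff A.module_axioms trilinear_add trilinear_scale)

lemma U_bilinear:
  "U.bilinear_on U_ambient (U_left t1 t2 t3)" "U.bilinear_on U_ambient (U_right t1 t2 t3)"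
  unfolding U.bilinear_on_def U.linear_on_def U_ambient_def DiEnd_def
  by (auto simp: U_defs scale_prod_def scale_fun_def module_hom_iff fun_eq_iff algebra_simps
      A.scale_right_distrib A.module_axioms A.scale_left_commute
      tri[THEN trilinear_add(1)] tri[THEN trilinear_add(2)] tri[THEN trilinear_add(3)]
      tri[THEN trilinear_scale(1)] tri[THEN trilinear_scale(2)] tri[THEN trilinear_scale(3)])

context
  assumes trisystem: "assoc_triple_trisystem1 scale t1 t2 t3"
begin

interpretation assoc_triple_trisystem1 scale t1 t2 t3 by (fact trisystem)

lemmas tri_zero = trilinear_zero[OF tri(1)] trilinear_zero[OF tri(2)] trilinear_zero[OF tri(3)]

lemma centre_normal_forms:
  "t1 (t1 a b c) d e = t1 a b (t1 c d e)" "t1 a (t1 b c d) e = t1 a b (t1 c d e)"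
  "t1 a (t2 b c d) e = t1 a b (t1 c d e)" "t1 a (t3 b c d) e = t1 a b (t1 c d e)"
  "t1 a b (t2 c d e) = t1 a b (t1 c d e)" "t1 a b (t3 c d e) = t1 a b (t1 c d e)"
  "t1 (t2 a b c) d e = t2 a b (t1 c d e)" "t2 a (t1 b c d) e = t2 a b (t1 c d e)"
  "t2 a b (t2 c d e) = t2 a b (t1 c d e)" "t2 a b (t3 c d e) = t2 a b (t1 c d e)"
  "t1 (t3 a b c) d e = t3 a b (t1 c d e)" "t2 a (t2 b c d) e = t3 a b (t1 c d e)"
  "t2 (t1 a b c) d e = t3 a b (t2 c d e)" "t2 (t2 a b c) d e = t3 a b (t2 c d e)"
  "t2 (t3 a b c) d e = t3 a b (t2 c d e)" "t2 a (t3 b c d) e = t3 a b (t2 c d e)"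
  "t3 (t1 a b c) d e = t3 a b (t3 c d e)" "t3 (t2 a b c) d e = t3 a b (t3 c d e)"
  "t3 (t3 a b c) d e = t3 a b (t3 c d e)" "t3 a (t1 b c d) e = t3 a b (t3 c d e)"
  "t3 a (t2 b c d) e = t3 a b (t3 c d e)" "t3 a (t3 b c d) e = t3 a b (t3 c d e)"
  using ax1[of a b c d e] ax2[of a b c d e] ax3[of a b c d e] ax4[of a b c d e]
    ax5[of a b c d e] ax6[of a b c d e] ax7[of a b c d e] ax8[of a b c d e]
    ax9[of a b c d e] ax10[of a b c d e] ax11[of a b c d e]
  by simp_all

lemma U_gens_products:
  "U_left t1 t2 t3 (tri_left t1 t2 t3 x y, 0) (tri_left t1 t2 t3 u v, 0) =
     (tri_left t1 t2 t3 x (t1 y u v), 0)"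
  "U_left t1 t2 t3 (tri_left t1 t2 t3 x y, 0) (tri_right t1 t2 t3 u v, 0) =
     (tri_left t1 t2 t3 x (t1 y u v), 0)"
  "U_left t1 t2 t3 (tri_right t1 t2 t3 x y, 0) (tri_left t1 t2 t3 u v, 0) =
     (tri_right t1 t2 t3 x (t1 y u v), 0)"
  "U_left t1 t2 t3 (tri_right t1 t2 t3 x y, 0) (tri_right t1 t2 t3 u v, 0) =
     (tri_right t1 t2 t3 x (t1 y u v), 0)"
  "U_right t1 t2 t3 (tri_left t1 t2 t3 x y, 0) (tri_left t1 t2 t3 u v, 0) =
     (tri_right t1 t2 t3 x (t2 y u v), 0)"
  "U_right t1 t2 t3 (tri_left t1 t2 t3 x y, 0) (tri_right t1 t2 t3 u v, 0) =
     (tri_right t1 t2 t3 x (t3 y u v), 0)"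
  "U_right t1 t2 t3 (tri_right t1 t2 t3 x y, 0) (tri_left t1 t2 t3 u v, 0) =
     (tri_right t1 t2 t3 x (t2 y u v), 0)"
  "U_right t1 t2 t3 (tri_right t1 t2 t3 x y, 0) (tri_right t1 t2 t3 u v, 0) =
     (tri_right t1 t2 t3 x (t3 y u v), 0)"
  by (simp_all add: U_defs fun_eq_iff zero_prod_def tri_zero centre_normal_forms)

lemma U_gens_closed:
  assumes "a \<in> U_gens" "b \<in> U_gens"
  shows "U_left t1 t2 t3 a b \<in> U_gens" "U_right t1 t2 t3 a b \<in> U_gens"
proof -
  have gens: "U_incl x \<in> U_gens" "(tri_left t1 t2 t3 x y, 0) \<in> U_gens"
    "(tri_right t1 t2 t3 x y, 0) \<in> U_gens" for x y
    by (auto simp: U_gens_def)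
  show "U_left t1 t2 t3 a b \<in> U_gens" "U_right t1 t2 t3 a b \<in> U_gens"
    using assms
    by (elim U_gens_cases; simp only: U_mixed_products[OF tri] U_gens_products gens)+
qed

lemma U_gens_laws:
  assumes "a \<in> U_gens" "b \<in> U_gens" "c \<in> U_gens"
  defines "l \<equiv> U_left t1 t2 t3" and "r \<equiv> U_right t1 t2 t3"
  shows "l (l a b) c = l a (l b c)" "l (r a b) c = r a (l b c)" "r (r a b) c = r a (r b c)"
    "l a (l b c) = l a (r b c)" "r (l a b) c = r (r a b) c"
  using assms(1-3) unfolding l_def r_def
  by (elim U_gens_cases; simp add: U_defs fun_eq_iff zero_prod_def tri_zero centre_normal_forms)+

lemma trisystem_imp_dialgebra:
  "assoc_dialgebra (scale_U scale) (U_carrier scale t1 t2 t3) (U_left t1 t2 t3) (U_right t1 t2 t3)"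
  unfolding U_carrier_eq_span
  by (intro U.assoc_dialgebra_spanI[OF U_ambient_subspace U_gens_ambient U_bilinear]
      U_gens_laws U.span_base U_gens_closed)

end

lemma U_triple_products:
  "U_incl (t1 x y z) = U_left t1 t2 t3 (U_incl x) (U_left t1 t2 t3 (U_incl y) (U_incl z))"
  "U_incl (t2 x y z) = U_right t1 t2 t3 (U_incl x) (U_left t1 t2 t3 (U_incl y) (U_incl z))"
  "U_incl (t3 x y z) = U_right t1 t2 t3 (U_incl x) (U_right t1 t2 t3 (U_incl y) (U_incl z))"
  by (simp_all only: U_mixed_products[OF tri])

lemma dialgebra_imp_trisystem:
  assumes "assoc_dialgebra (scale_U scale) (U_carrier scale t1 t2 t3)
    (U_left t1 t2 t3) (U_right t1 t2 t3)"
  shows "assoc_triple_trisystem1 scale t1 t2 t3"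
proof -
  interpret D: assoc_dialgebra "scale_U scale" "U_carrier scale t1 t2 t3"
    "U_left t1 t2 t3" "U_right t1 t2 t3" by fact
  show ?thesis
    by (intro assoc_triple_trisystem1.intro assoc_triple_trisystem1_axioms.intro tri;
        subst U_incl_eq_iff[symmetric];
        simp only: U_triple_products U_incl_carrier D.left_closed D.right_closed D.left_left
          D.right_left D.right_right D.right_bar D.left_bar[symmetric])
qed

end

theorem theorem13:
  fixes scale :: "'r::comm_ring_1 \<Rightarrow> 'a::ab_group_add \<Rightarrow> 'a"
    and t1 t2 t3 :: "'a \<Rightarrow> 'a \<Rightarrow> 'a \<Rightarrow> 'a"
  assumes "\<exists>h::'r. 2 * h = 1"
    and "module scale"
    and "trilinear scale t1" and "trilinear scale t2" and "trilinear scale t3"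
  shows "(assoc_triple_trisystem1 scale t1 t2 t3 \<longleftrightarrow>
            assoc_dialgebra (scale_U scale) (U_carrier scale t1 t2 t3)
              (U_left t1 t2 t3) (U_right t1 t2 t3)) \<and>
         (\<forall>x y z.
            U_incl (t1 x y z) =
              U_left t1 t2 t3 (U_incl x) (U_left t1 t2 t3 (U_incl y) (U_incl z)) \<and>
            U_incl (t2 x y z) =
              U_right t1 t2 t3 (U_incl x) (U_left t1 t2 t3 (U_incl y) (U_incl z)) \<and>
            U_incl (t3 x y z) =
              U_right t1 t2 t3 (U_incl x) (U_right t1 t2 t3 (U_incl y) (U_incl z)))"
  using trisystem_imp_dialgebra[OF assms(3-5)] dialgebra_imp_trisystem[OF assms(3-5)]
    U_triple_products[OF assms(3-5)]
  by blast

end
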